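(* Let $n,r\ge1$ and $c\in\{1,\dots,n\}$ be integers. Let $P_1,\dots,P_r$ be generic points in $\mathbb{P}^n$, let $H\subset\mathbb{P}^n$ be a hyperplane such that $H\cap\Delta_0=\emptyset$, and set $H_i=P_i\star H$ for all $i\in\{1,\dots,r\}$. Then $\mathbb{X}_c(H_1,\dots,H_r)$ is a weak Hadamard star configuration. (That is, there is an open dense subset $U\subseteq(\mathbb{P}^n)^r$ such that the conclusion holds for every $(P_1,\dots,P_r)\in U$ and every such $H$.)
   Context: Work over $\mathbb{C}$; $S=\mathbb{C}[x_0,\dots,x_n]$ is the coordinate ring of $\mathbb{P}^n$, and $S_1$ is the space of linear forms. $\Delta_0$ is the set of the $n+1$ coordinate points of $\mathbb{P}^n$. A statement holds for generic points $P_1,\dots,P_r\in\mathbb{P}^n$ if it holds for all $(P_1,\dots,P_r)$ in some open dense (Zariski topology) subset of $(\mathbb{P}^n)^r$. Hadamard product: for points $A=[a_0:\dots:a_n]$, $B=[b_0:\dots:b_n]$ with $a_ib_i\ne0$ for some $i$, $A\star B=[a_0b_0:\dots:a_nb_n]$ (otherwise it is not defined). For a point $P$ and a variety $X$, $P\star X$ is the closure of $\{P\star Q: Q\in X,\ P\star Q\text{ defined}\}$. If all coordinates of $P=[p_0:\dots:p_n]$ are nonzero and $H=V(\sum a_ix_i)$, then $P\star H=V(\sum (a_i/p_i)x_i)$. A collection of linear forms $\mathcal{L}=\{L_1,\dots,L_r\}\subset S_1$ is generally linear if any $t\le n$ of them have common zero locus of dimension $n-t$ and any $t>n$ of them have empty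 common zero locus in $\mathbb{P}^n$. For generally linear $\mathcal{L}$ and $1\le c\le n$, the codimension $c$ star configuration defined by $\mathcal{L}$ is $\mathbb{X}_c(\mathcal{L})=\bigcup_{1\le i_1<\dots<i_c\le r}V(L_{i_1},\dots,L_{i_c})$. $\mathcal{L}$ is a Hadamard set if there are a linear form $L\in S_1$ and points $P_1,\dots,P_r\in\mathbb{P}^n$ with $V(L_i)=P_i\star V(L)$ for all $i$. A star configuration $\mathbb{X}_c(\mathcal{L})$ is a weak Hadamard star configuration (WHSC) if $\mathcal{L}$ is a Hadamard set. For hyperplanes $H_i=V(L_i)$, $\mathbb{X}_c(H_1,\dots,H_r)=\bigcup_{1\le i_1<\dots<i_c\le r}H_{i_1}\cap\dots\cap H_{i_c}$; it is called a WHSC when $\{L_1,\dots,L_r\}$ is generally linear (so that it is a star configuration) and is a Hadamard set. *)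

theory Defs
  imports "HOL-Analysis.Analysis" "HOL-Library.Poly_Mapping"
begin

section \<open>Complex projective space\<close>

text \<open>Homogeneous coordinates are indexed by a finite type \<open>'v\<close>, so \<^typ>\<open>complex ^ 'v\<close> modulo
  scaling (without the origin) is the projective space of dimension \<open>CARD('v) - 1\<close>.\<close>

definition proportional :: "complex ^ 'v \<Rightarrow> complex ^ 'v \<Rightarrow> bool" where
  "proportional a b \<longleftrightarrow> a \<noteq> 0 \<and> (\<exists>k. k \<noteq> 0 \<and> b = k *s a)"

lemma part_equivp_proportional: "part_equivp (proportional :: complex ^ 'v \<Rightarrow> _)"
proof (rule part_equivpI)
  have "proportional 1 (1 :: complex ^ 'v)"
    unfolding proportional_def by (auto simp: vec_eq_iff intro!: exI[of _ 1])
  then show "\<exists>x :: complex ^ 'v. proportional x x" by blast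
  show "symp (proportional :: complex ^ 'v \<Rightarrow> _)"
  proof (rule sympI)
    fix a b :: "complex ^ 'v"
    assume "proportional a b"
    then obtain k where k: "a \<noteq> 0" "k \<noteq> 0" "b = k *s a"
      by (auto simp: proportional_def)
    then have "a = inverse k *s b" by (simp add: vector_smult_assoc)
    with k show "proportional b a"
      unfolding proportional_def by (metis inverse_nonzero_iff_nonzero vector_mul_eq_0)
  qed
  show "transp (proportional :: complex ^ 'v \<Rightarrow> _)"
  proof (rule transpI)
    fix a b c :: "complex ^ 'v"
    assume "proportional a b" "proportional b c"
    then show "proportional a c"
      unfolding proportional_def by (metis mult_eq_0_iff vector_smult_assoc)
  qed
qed

quotient_type 'v proj = "complex ^ 'v" / partial: proportional
  by (rule part_equivp_proportional)

text \<open>\<open>point a\<close> is \<open>[a\<^sub>0 : \<dots> : a\<^sub>n]\<close>; it is meaningful only for \<open>a \<noteq> 0\<close>.\<close>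

definition point :: "complex ^ 'v \<Rightarrow> 'v proj" where
  "point a = abs_proj a"

lemma proportional_self_iff: "proportional a a \<longleftrightarrow> a \<noteq> 0"
  unfolding proportional_def by (auto intro!: exI[of _ 1])

lemma point_eq_iff:
  assumes "a \<noteq> 0" "b \<noteq> 0"
  shows "point a = point b \<longleftrightarrow> (\<exists>k. k \<noteq> 0 \<and> b = k *s a)"
  using Quotient_rel[OF Quotient_proj, of a b] assms
  unfolding point_def proportional_self_iff by (simp add: proportional_def)

lemma rep_proj_nonzero: "rep_proj P \<noteq> 0"
  using Quotient_rep_reflp[OF Quotient_proj, of P] by (simp add: proportional_self_iff)

lemma point_rep_proj: "point (rep_proj P) = P"
  unfolding point_def by (rule Quotient_abs_rep[OF Quotient_proj])

definition coordinate_points :: "'v::finite proj set" where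
  "coordinate_points = range (\<lambda>i. point (axis i 1))"


section \<open>Polynomials, zero loci and Zariski topologies\<close>

type_synonym 'x mpoly = "('x \<Rightarrow>\<^sub>0 nat) \<Rightarrow>\<^sub>0 complex"

definition poly_eval :: "'x::finite mpoly \<Rightarrow> ('x \<Rightarrow> complex) \<Rightarrow> complex" where
  "poly_eval f x =
    (\<Sum>m\<in>Poly_Mapping.keys f. Poly_Mapping.lookup f m * (\<Prod>i\<in>UNIV. x i ^ Poly_Mapping.lookup m i))"

definition homogeneous :: "nat \<Rightarrow> 'v::finite mpoly \<Rightarrow> bool" where
  "homogeneous d f \<longleftrightarrow> (\<forall>m\<in>Poly_Mapping.keys f. (\<Sum>i\<in>UNIV. Poly_Mapping.lookup m i) = d)"

text \<open>The variable \<open>(j, i)\<close> is the \<open>i\<close>-th homogeneous coordinate on the \<open>j\<close>-th factor.\<close>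

definition multihomogeneous :: "('r \<Rightarrow> nat) \<Rightarrow> ('r::finite \<times> 'v::finite) mpoly \<Rightarrow> bool" where
  "multihomogeneous d f \<longleftrightarrow>
    (\<forall>m\<in>Poly_Mapping.keys f. \<forall>j. (\<Sum>i\<in>UNIV. Poly_Mapping.lookup m (j, i)) = d j)"

definition linear_forms :: "'v::finite mpoly set" where
  "linear_forms = {f. homogeneous 1 f}"

definition coords :: "'v proj \<Rightarrow> ('v::finite \<Rightarrow> complex) set" where
  "coords P = {($) a |a. a \<noteq> 0 \<and> point a = P}"

definition multicoords :: "('r \<Rightarrow> 'v proj) \<Rightarrow> ('r \<times> 'v::finite \<Rightarrow> complex) set" where
  "multicoords P = {x. \<forall>j. (\<lambda>i. x (j, i)) \<in> coords (P j)}"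

definition zeros :: "('p \<Rightarrow> ('x::finite \<Rightarrow> complex) set) \<Rightarrow> 'x mpoly set \<Rightarrow> 'p set" where
  "zeros C F = {P. \<forall>f\<in>F. \<forall>x\<in>C P. poly_eval f x = 0}"

abbreviation V :: "'v::finite mpoly set \<Rightarrow> 'v proj set" where
  "V \<equiv> zeros coords"

text \<open>The Zariski topologies on the projective space and on its \<open>r\<close>-fold product, where \<open>'r\<close> is an
  index type with \<open>r\<close> elements. The latter is not the product of the former.\<close>

definition zariski :: "'v::finite proj topology" where
  "zariski = topology (\<lambda>U. \<exists>F. (\<forall>f\<in>F. \<exists>d. homogeneous d f) \<and> U = - V F)"

definition multizariski :: "('r::finite \<Rightarrow> 'v::finite proj) topology" where
  "multizariski =
    topology (\<lambda>U. \<exists>F. (\<forall>f\<in>F. \<exists>d. multihomogeneous d f) \<and> U = - zeros multicoords F)"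


subsection \<open>These are topologies\<close>

lemma poly_eval_superset:
  assumes "finite A" "Poly_Mapping.keys f \<subseteq> A"
  shows "poly_eval f x =
    (\<Sum>m\<in>A. Poly_Mapping.lookup f m * (\<Prod>i\<in>UNIV. x i ^ Poly_Mapping.lookup m i))"
  unfolding poly_eval_def using assms
  by (intro sum.mono_neutral_left) (auto simp: in_keys_iff)

lemma poly_eval_zero [simp]: "poly_eval 0 x = 0"
  by (simp add: poly_eval_def)

lemma poly_eval_one [simp]: "poly_eval 1 x = 1"
  by (simp add: poly_eval_def)

lemma poly_eval_single:
  "poly_eval (Poly_Mapping.single m c) x = c * (\<Prod>i\<in>UNIV. x i ^ Poly_Mapping.lookup m i)"
  by (cases "c = 0") (simp_all add: poly_eval_def)

lemma poly_eval_add: "poly_eval (f + g) x = poly_eval f x + poly_eval g x"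
proof -
  let ?A = "Poly_Mapping.keys f \<union> Poly_Mapping.keys g"
  have "Poly_Mapping.keys (f + g) \<subseteq> ?A" by (rule Poly_Mapping.keys_add)
  then show ?thesis
    by (simp add: poly_eval_superset[of ?A] lookup_add distrib_right sum.distrib)
qed

lemma mpoly_induct [case_names zero add]:
  assumes "P 0" and add: "\<And>f m c. P f \<Longrightarrow> P (f + Poly_Mapping.single m c)"
  shows "P (f :: 'x mpoly)"
proof (induction f rule: Poly_Mapping.update_induct)
  case const
  show ?case by fact
next
  case (update f a b)
  have "Poly_Mapping.update a b f = f + Poly_Mapping.single a b"
    using update.hyps
    by (intro poly_mapping_eqI)
      (auto simp: lookup_update lookup_add lookup_single in_keys_iff)
  then show ?case using add[OF update.IH, of a b] by simp
qed

lemma poly_eval_mult: "poly_eval (f * g) x = poly_eval f x * poly_eval g x"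
proof (induction f rule: mpoly_induct)
  case zero
  then show ?case by simp
next
  case (add f m c)
  have "poly_eval (Poly_Mapping.single m c * g) x = poly_eval (Poly_Mapping.single m c) x * poly_eval g x"
    by (induction g rule: mpoly_induct)
      (simp_all add: distrib_left mult_single poly_eval_add poly_eval_single lookup_add power_add
        prod.distrib)
  with add show ?case by (simp add: distrib_right poly_eval_add)
qed

lemma homogeneous_mult: "homogeneous d f \<Longrightarrow> homogeneous e g \<Longrightarrow> homogeneous (d + e) (f * g)"
  unfolding homogeneous_def using keys_mult[of f g]
  by (fastforce simp: lookup_add sum.distrib)

lemma multihomogeneous_mult:
  "multihomogeneous d f \<Longrightarrow> multihomogeneous e g \<Longrightarrow> multihomogeneous (\<lambda>j. d j + e j) (f * g)"
  unfolding multihomogeneous_def using keys_mult[of f g]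
  by (fastforce simp: lookup_add sum.distrib)

lemma poly_eval_multihomogeneous:
  assumes "multihomogeneous d f"
  shows "poly_eval f (\<lambda>(j, i). k j * x (j, i)) = (\<Prod>j\<in>UNIV. k j ^ d j) * poly_eval f x"
  unfolding poly_eval_def sum_distrib_left
proof (rule sum.cong[OF refl])
  fix m assume m: "m \<in> Poly_Mapping.keys f"
  have "(\<Prod>p\<in>UNIV. k (fst p) ^ Poly_Mapping.lookup m p) = (\<Prod>j\<in>UNIV. \<Prod>i\<in>UNIV. k j ^ Poly_Mapping.lookup m (j, i))"
    unfolding UNIV_Times_UNIV[symmetric] prod.cartesian_product by (simp add: case_prod_beta)
  also have "\<dots> = (\<Prod>j\<in>UNIV. k j ^ d j)"
    using assms m by (simp add: multihomogeneous_def flip: power_sum)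
  finally show "Poly_Mapping.lookup f m *
      (\<Prod>p\<in>UNIV. (case p of (j, i) \<Rightarrow> k j * x (j, i)) ^ Poly_Mapping.lookup m p) =
      (\<Prod>j\<in>UNIV. k j ^ d j) * (Poly_Mapping.lookup f m * (\<Prod>p\<in>UNIV. x p ^ Poly_Mapping.lookup m p))"
    by (simp add: case_prod_beta power_mult_distrib prod.distrib)
qed

lemma poly_eval_homogeneous:
  assumes "homogeneous d f"
  shows "poly_eval f (\<lambda>i. k * x i) = k ^ d * poly_eval f x"
  unfolding poly_eval_def sum_distrib_left
  using assms
  by (intro sum.cong)
    (auto simp: homogeneous_def power_mult_distrib prod.distrib power_sum[symmetric])

lemma coords_scale:
  assumes "x \<in> coords P" "y \<in> coords P"
  shows "\<exists>k. k \<noteq> 0 \<and> y = (\<lambda>i. k * x i)"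
proof -
  from assms obtain a b where "x = ($) a" "y = ($) b" "a \<noteq> 0" "b \<noteq> 0" "point a = point b"
    by (auto simp: coords_def)
  then show ?thesis by (auto simp: point_eq_iff fun_eq_iff)
qed

lemma coords_nonempty: "coords P \<noteq> {}"
  unfolding coords_def using point_rep_proj[of P] rep_proj_nonzero[of P] by blast

lemma istopology_complements_of_zeros:
  assumes one: "H 1" and mult: "\<And>f g. H f \<Longrightarrow> H g \<Longrightarrow> H (f * g)"
    and nonempty: "\<And>P. C P \<noteq> {}"
    and indep: "\<And>f P x y. H f \<Longrightarrow> x \<in> C P \<Longrightarrow> y \<in> C P \<Longrightarrow> poly_eval f x = 0 \<Longrightarrow> poly_eval f y = 0"
  shows "istopology (\<lambda>U. \<exists>F. (\<forall>f\<in>F. H f) \<and> U = - zeros C F)"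
  unfolding istopology_def
proof (intro conjI allI impI)
  fix S T assume "\<exists>F. (\<forall>f\<in>F. H f) \<and> S = - zeros C F" "\<exists>F. (\<forall>f\<in>F. H f) \<and> T = - zeros C F"
  then obtain F G where F: "\<forall>f\<in>F. H f" "S = - zeros C F" and G: "\<forall>f\<in>G. H f" "T = - zeros C G"
    by blast
  let ?FG = "{f * g |f g. f \<in> F \<and> g \<in> G}"
  have "zeros C ?FG \<subseteq> zeros C F \<union> zeros C G"
  proof
    fix P assume P: "P \<in> zeros C ?FG"
    show "P \<in> zeros C F \<union> zeros C G"
    proof (rule ccontr)
      assume "P \<notin> zeros C F \<union> zeros C G"
      then obtain f g x y where *: "f \<in> F" "x \<in> C P" "poly_eval f x \<noteq> 0"
        "g \<in> G" "y \<in> C P" "poly_eval g y \<noteq> 0"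
        by (auto simp: zeros_def)
      then have "poly_eval g x \<noteq> 0" using indep G(1) by blast
      moreover have "poly_eval (f * g) x = 0" using P * by (auto simp: zeros_def)
      ultimately show False using * by (simp add: poly_eval_mult)
    qed
  qed
  moreover have "zeros C F \<union> zeros C G \<subseteq> zeros C ?FG"
    by (auto simp: zeros_def poly_eval_mult)
  ultimately have "S \<inter> T = - zeros C ?FG" using F G by blast
  moreover have "\<forall>f\<in>?FG. H f" using F G mult by blast
  ultimately show "\<exists>F. (\<forall>f\<in>F. H f) \<and> S \<inter> T = - zeros C F" by blast
next
  fix K assume "\<forall>S\<in>K. \<exists>F. (\<forall>f\<in>F. H f) \<and> S = - zeros C F"
  then obtain F where F: "\<And>S. S \<in> K \<Longrightarrow> (\<forall>f\<in>F S. H f) \<and> S = - zeros C (F S)"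
    by metis
  have "zeros C (\<Union>(F ` K)) = (\<Inter>S\<in>K. zeros C (F S))" by (auto simp: zeros_def)
  then have "\<Union>K = - zeros C (\<Union>(F ` K))" using F by auto
  moreover have "\<forall>f\<in>\<Union>(F ` K). H f" using F by blast
  ultimately show "\<exists>F. (\<forall>f\<in>F. H f) \<and> \<Union>K = - zeros C F" by blast
qed

lemma openin_zariski:
  fixes U :: "'v::finite proj set"
  shows "openin zariski U \<longleftrightarrow> (\<exists>F. (\<forall>f\<in>F. \<exists>d. homogeneous d f) \<and> U = - V F)"
proof -
  have "istopology (\<lambda>U :: 'v proj set. \<exists>F. (\<forall>f\<in>F. \<exists>d. homogeneous d f) \<and> U = - V F)"
  proof (rule istopology_complements_of_zeros)
    show "\<exists>d. homogeneous d 1" by (auto simp: homogeneous_def)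
    show "\<exists>d. homogeneous d (f * g)" if "\<exists>d. homogeneous d f" "\<exists>d. homogeneous d g"
      for f g :: "'v mpoly"
      using that homogeneous_mult by blast
    show "coords P \<noteq> {}" for P :: "'v proj" by (rule coords_nonempty)
    show "poly_eval f y = 0"
      if f: "\<exists>d. homogeneous d f" and "x \<in> coords P" "y \<in> coords P" and 0: "poly_eval f x = 0"
      for f :: "'v mpoly" and P x y
    proof -
      obtain k where "y = (\<lambda>i. k * x i)" using \<open>x \<in> _\<close> \<open>y \<in> _\<close> coords_scale by blast
      then show ?thesis using f 0 by (auto simp: poly_eval_homogeneous)
    qed
  qed
  then show ?thesis unfolding zariski_def by simp
qed

lemma openin_multizariski:
  fixes U :: "('r::finite \<Rightarrow> 'v::finite proj) set"
  shows "openin multizariski U \<longleftrightarrow>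
    (\<exists>F. (\<forall>f\<in>F. \<exists>d. multihomogeneous d f) \<and> U = - zeros multicoords F)"
proof -
  have "istopology (\<lambda>U :: ('r \<Rightarrow> 'v proj) set.
      \<exists>F. (\<forall>f\<in>F. \<exists>d. multihomogeneous d f) \<and> U = - zeros multicoords F)"
  proof (rule istopology_complements_of_zeros)
    show "\<exists>d. multihomogeneous d 1" by (auto simp: multihomogeneous_def)
    show "\<exists>d. multihomogeneous d (f * g)"
      if "\<exists>d. multihomogeneous d f" "\<exists>d. multihomogeneous d g" for f g :: "('r \<times> 'v) mpoly"
      using that multihomogeneous_mult by blast
    show "multicoords P \<noteq> {}" for P :: "'r \<Rightarrow> 'v proj"
    proof -
      have "(SOME x. x \<in> coords (P j)) \<in> coords (P j)" for j
        by (rule some_in_eq[THEN iffD2, OF coords_nonempty])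
      then have "(\<lambda>(j, i). (SOME x. x \<in> coords (P j)) i) \<in> multicoords P"
        by (simp add: multicoords_def)
      then show ?thesis by blast
    qed
    show "poly_eval f y = 0"
      if f: "\<exists>d. multihomogeneous d f" and x: "x \<in> multicoords P" and y: "y \<in> multicoords P"
        and 0: "poly_eval f x = 0"
      for f :: "('r \<times> 'v) mpoly" and P x y
    proof -
      have "\<exists>k. \<forall>i. y (j, i) = k * x (j, i)" for j
        using coords_scale[of "\<lambda>i. x (j, i)" "P j" "\<lambda>i. y (j, i)"] x y
        by (auto simp: multicoords_def fun_eq_iff)
      then obtain k where "\<And>j i. y (j, i) = k j * x (j, i)" by metis
      then have "y = (\<lambda>(j, i). k j * x (j, i))" by auto
      then show ?thesis using f 0 by (auto simp: poly_eval_multihomogeneous)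
    qed
  qed
  then show ?thesis unfolding multizariski_def by simp
qed


section \<open>Hadamard products\<close>

text \<open>The product of two points is partial. It does not depend on the chosen representatives, see
  \<open>hadamard_point\<close>.\<close>

definition hadamard :: "'v::finite proj \<Rightarrow> 'v proj \<Rightarrow> 'v proj option" where
  "hadamard P Q =
    (let c = (\<chi> i. rep_proj P $ i * rep_proj Q $ i) in if c = 0 then None else Some (point c))"

lemma hadamard_point:
  assumes "a \<noteq> 0" "b \<noteq> 0"
  shows "hadamard (point a) (point b) =
    (if \<exists>i. a $ i * b $ i \<noteq> 0 then Some (point (\<chi> i. a $ i * b $ i)) else None)"
proof -
  obtain k where k: "k \<noteq> 0" "rep_proj (point a) = k *s a"
    using point_eq_iff[of a "rep_proj (point a)"] assms rep_proj_nonzero point_rep_proj by metis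
  obtain l where l: "l \<noteq> 0" "rep_proj (point b) = l *s b"
    using point_eq_iff[of b "rep_proj (point b)"] assms rep_proj_nonzero point_rep_proj by metis
  let ?c = "\<chi> i. a $ i * b $ i" and ?c' = "\<chi> i. rep_proj (point a) $ i * rep_proj (point b) $ i"
  have c': "?c' = (k * l) *s ?c" by (simp add: k l vec_eq_iff)
  have "?c = 0 \<longleftrightarrow> \<not> (\<exists>i. a $ i * b $ i \<noteq> 0)" by (simp add: vec_eq_iff)
  moreover have "?c' = 0 \<longleftrightarrow> ?c = 0" unfolding c' using k l by simp
  moreover have "point ?c' = point ?c" if "?c \<noteq> 0"
  proof -
    have "?c' \<noteq> 0" using that \<open>?c' = 0 \<longleftrightarrow> ?c = 0\<close> by simp
    with that have "point ?c = point ?c' \<longleftrightarrow> (\<exists>m. m \<noteq> 0 \<and> ?c' = m *s ?c)" by (rule point_eq_iff)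
    moreover have "k * l \<noteq> 0" using k l by simp
    ultimately show ?thesis using c' by metis
  qed
  ultimately show ?thesis unfolding hadamard_def Let_def by simp
qed

definition hadamard_variety :: "'v::finite proj \<Rightarrow> 'v proj set \<Rightarrow> 'v proj set"
    (infixr \<open>\<star>\<close> 70) where
  "P \<star> X = zariski closure_of {R. \<exists>Q\<in>X. hadamard P Q = Some R}"


section \<open>Star configurations\<close>

text \<open>The dimension of a projective linear subspace is one less than the dimension of its affine
  cone, and \<open>-1\<close> for the empty set. Only zero loci of linear forms are measured below; for a set
  that is not a linear subspace this is the dimension of its linear span.\<close>

definition linear_dim :: "'v::finite proj set \<Rightarrow> int" where
  "linear_dim X = int (vec.dim {a. a = 0 \<or> point a \<in> X}) - 1"

definition hyperplane :: "'v::finite proj set \<Rightarrow> bool" where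
  "hyperplane H \<longleftrightarrow> (\<exists>L\<in>linear_forms. L \<noteq> 0 \<and> H = V {L})"

text \<open>A collection \<open>L\<^sub>1, \<dots>, L\<^sub>r\<close> is a family over the index type \<open>'r\<close>, so repeated forms count
  separately.\<close>

definition generally_linear :: "('r::finite \<Rightarrow> 'v::finite mpoly) \<Rightarrow> bool" where
  "generally_linear L \<longleftrightarrow>
    (let n = CARD('v) - 1 in
      (\<forall>j. L j \<in> linear_forms) \<and>
      (\<forall>J. card J \<le> n \<longrightarrow> linear_dim (V (L ` J)) = int n - int (card J)) \<and>
      (\<forall>J. card J > n \<longrightarrow> V (L ` J) = {}))"

definition hadamard_set :: "('r::finite \<Rightarrow> 'v::finite mpoly) \<Rightarrow> bool" where
  "hadamard_set L \<longleftrightarrow> (\<exists>M\<in>linear_forms. \<exists>P. \<forall>j. V {L j} = P j \<star> V {M})"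

definition star_configuration :: "nat \<Rightarrow> ('r::finite \<Rightarrow> 'v::finite proj set) \<Rightarrow> 'v proj set" where
  "star_configuration c H = (\<Union>J\<in>{J. card J = c}. \<Inter>j\<in>J. H j)"

text \<open>\<open>X\<close> is the weak Hadamard star configuration of codimension \<open>c\<close> defined by \<open>L\<close>.\<close>

definition weak_hadamard_star_configuration ::
    "nat \<Rightarrow> ('r::finite \<Rightarrow> 'v::finite mpoly) \<Rightarrow> 'v proj set \<Rightarrow> bool" where
  "weak_hadamard_star_configuration c L X \<longleftrightarrow>
    1 \<le> c \<and> c \<le> CARD('v) - 1 \<and> generally_linear L \<and>
    X = star_configuration c (\<lambda>j. V {L j}) \<and> hadamard_set L"

end

theory Submission
  imports Defs "HOL-Computational_Algebra.Polynomial"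
begin

text \<open>Write \<open>H\<close> as the zero locus of \<open>\<Sum>a\<^sub>kx\<^sub>k\<close>. That \<open>H\<close> avoids the coordinate points means that no
  \<open>a\<^sub>k\<close> vanishes, and \<open>P\<^sub>j \<star> H\<close> is then cut out by the row \<open>(a\<^sub>k / p\<^sub>j\<^sub>k)\<^sub>k\<close> as soon as all coordinates of
  \<open>P\<^sub>j\<close> are nonzero (\<open>hadamard_variety_hyperplane\<close>). So these hyperplanes form a Hadamard set by
  construction, and the content is that they are generally linear: any \<open>n + 1\<close> or fewer of the
  rows must be linearly independent. Scaling the columns by the nonzero \<open>a\<^sub>k\<close> does not affect
  independence, which is why one condition on the points serves all hyperplanes \<open>H\<close> at once.
  Scaling the rows does not matter either, so \<open>1 / p\<^sub>j\<^sub>k\<close> can be replaced by the product of the other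
  coordinates of \<open>P\<^sub>j\<close>; this is the standard Cremona transformation, and it is polynomial.

  Independence of at most \<open>n + 1\<close> rows is certified by one determinant of size \<open>n + 1\<close>: place the
  chosen rows at distinct positions of a square matrix and fill the other positions with unit vectors
  (\<open>padded_minor\<close>). There are finitely many such placements, and the set \<open>U\<close> is where all the
  determinants and all coordinates are nonzero. It is the nonvanishing locus of one
  multihomogeneous polynomial, hence open. It is dense because a product of polynomials, each
  of which is nonzero somewhere, is nonzero somewhere (\<open>poly_eval_common_nonzero\<close>); and each determinant
  is nonzero somewhere because the Cremona transformation in polynomial form sends a point with
  exactly one zero coordinate to a coordinate point, so that the matrix can be made the identity.

  On \<open>U\<close>, the invertible matrix turns the common zeros of the chosen linear forms into a coordinate
  subspace, whose dimension is known (\<open>dim_common_kernel\<close>).\<close>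

section \<open>Multihomogeneous functions and density\<close>

lemma poly_eval_along_line:
  "\<exists>q :: complex poly. \<forall>t. poly q t = poly_eval f (\<lambda>i. a i + t * b i)"
proof -
  let ?q = "\<Sum>m\<in>Poly_Mapping.keys f. Polynomial.smult (Poly_Mapping.lookup f m)
     (\<Prod>i\<in>UNIV. [:a i, b i:] ^ Poly_Mapping.lookup m i)"
  have "poly ?q t = poly_eval f (\<lambda>i. a i + t * b i)" for t
    by (simp add: poly_eval_def poly_sum poly_prod)
  then show ?thesis by blast
qed

text \<open>On the line through \<open>a\<close> and \<open>b\<close> both polynomials become nonzero polynomials in one variable, so
  together they have only finitely many zeros there. This is the irreducibility of affine space
  over an infinite field.\<close>

lemma poly_eval_common_nonzero:
  assumes "poly_eval f a \<noteq> 0" "poly_eval g b \<noteq> 0"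
  shows "\<exists>x. poly_eval f x \<noteq> 0 \<and> poly_eval g x \<noteq> 0"
proof -
  obtain p where p: "\<And>t. poly p t = poly_eval f (\<lambda>i. a i + t * (b i - a i))"
    using poly_eval_along_line[of f a "\<lambda>i. b i - a i"] by blast
  obtain q where q: "\<And>t. poly q t = poly_eval g (\<lambda>i. a i + t * (b i - a i))"
    using poly_eval_along_line[of g a "\<lambda>i. b i - a i"] by blast
  have "poly p 0 \<noteq> 0" "poly q 1 \<noteq> 0" using assms p[of 0] q[of 1] by simp_all
  then have "p * q \<noteq> 0" by auto
  then have "finite {t. poly (p * q) t = 0}" by (rule poly_roots_finite)
  then obtain t where "t \<notin> {t. poly (p * q) t = 0}"
    using ex_new_if_finite[OF infinite_UNIV_char_0] by blast
  then show ?thesis using p q by auto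
qed

text \<open>Multihomogeneous polynomials are handled through the functions that they define, so that
  products and determinants can be written as ordinary expressions in the coordinates.\<close>

definition multiform ::
    "('r \<Rightarrow> nat) \<Rightarrow> (('r::finite \<times> 'v::finite \<Rightarrow> complex) \<Rightarrow> complex) \<Rightarrow> bool" where
  "multiform d F \<longleftrightarrow> (\<exists>f. multihomogeneous d f \<and> F = poly_eval f)"

lemma multiform_zero: "multiform d (\<lambda>_. 0)"
  unfolding multiform_def by (rule exI[of _ 0]) (simp add: multihomogeneous_def fun_eq_iff)

lemma multiform_const: "multiform (\<lambda>_. 0) (\<lambda>_. c)"
  unfolding multiform_def
  by (rule exI[of _ "Poly_Mapping.single 0 c"])
    (simp add: multihomogeneous_def poly_eval_single fun_eq_iff)

lemma multiform_coordinate: "multiform (\<lambda>j'. of_bool (j' = j)) (\<lambda>x. x (j, i))"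
  unfolding multiform_def
proof (intro exI conjI)
  let ?m = "Poly_Mapping.single (j, i) (1 :: nat)"
  have "(\<Sum>i'\<in>UNIV. Poly_Mapping.lookup ?m (j', i')) = of_bool (j' = j)" for j'
    by (cases "j' = j") (simp_all add: lookup_single when_def)
  then show "multihomogeneous (\<lambda>j'. of_bool (j' = j)) (Poly_Mapping.single ?m 1)"
    by (simp add: multihomogeneous_def)
  have "(\<Prod>p\<in>UNIV. x p ^ Poly_Mapping.lookup ?m p) = x (j, i)" for x :: "_ \<Rightarrow> complex"
  proof -
    have "(\<Prod>p\<in>UNIV. x p ^ Poly_Mapping.lookup ?m p) = (\<Prod>p\<in>UNIV. if p = (j, i) then x p else 1)"
      by (rule prod.cong) (auto simp: lookup_single when_def)
    then show ?thesis by simp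
  qed
  then show "(\<lambda>x. x (j, i)) = poly_eval (Poly_Mapping.single ?m 1)"
    by (simp add: poly_eval_single fun_eq_iff)
qed

lemma multiform_mult:
  assumes "multiform d F" "multiform e G"
  shows "multiform (\<lambda>j. d j + e j) (\<lambda>x. F x * G x)"
proof -
  obtain f g where fg: "multihomogeneous d f" "F = poly_eval f" "multihomogeneous e g" "G = poly_eval g"
    using assms unfolding multiform_def by blast
  have "(\<lambda>x. F x * G x) = poly_eval (f * g)" by (simp add: fg(2,4) poly_eval_mult fun_eq_iff)
  with multihomogeneous_mult[OF fg(1,3)] show ?thesis unfolding multiform_def by blast
qed

lemma multiform_add:
  assumes "multiform d F" "multiform d G"
  shows "multiform d (\<lambda>x. F x + G x)"
proof -
  obtain f g where fg: "multihomogeneous d f" "F = poly_eval f" "multihomogeneous d g" "G = poly_eval g"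
    using assms unfolding multiform_def by blast
  have "multihomogeneous d (f + g)"
    using fg(1,3) Poly_Mapping.keys_add[of f g] unfolding multihomogeneous_def by blast
  moreover have "(\<lambda>x. F x + G x) = poly_eval (f + g)"
    by (simp add: fg(2,4) poly_eval_add fun_eq_iff)
  ultimately show ?thesis unfolding multiform_def by blast
qed

lemma multiform_sum:
  "(\<And>a. a \<in> A \<Longrightarrow> multiform d (F a)) \<Longrightarrow> multiform d (\<lambda>x. \<Sum>a\<in>A. F a x)"
  by (induction A rule: infinite_finite_induct) (simp_all add: multiform_zero multiform_add)

lemma multiform_prod:
  "(\<And>a. a \<in> A \<Longrightarrow> multiform (d a) (F a)) \<Longrightarrow>
    multiform (\<lambda>j. \<Sum>a\<in>A. d a j) (\<lambda>x. \<Prod>a\<in>A. F a x)"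
  by (induction A rule: infinite_finite_induct) (simp_all add: multiform_const multiform_mult)

text \<open>Every term of the Leibniz expansion takes one entry from each row, so it suffices that the
  degree of an entry depends on its row only.\<close>

lemma multiform_det:
  fixes M :: "('r::finite \<times> 'v::finite \<Rightarrow> complex) \<Rightarrow> complex ^ 'n ^ 'n"
  assumes "\<And>i k. multiform (d i) (\<lambda>x. M x $ i $ k)"
  shows "multiform (\<lambda>j. \<Sum>i\<in>UNIV. d i j) (\<lambda>x. det (M x))"
proof -
  have "multiform (\<lambda>j. 0 + (\<Sum>i\<in>UNIV. d i j))
      (\<lambda>x. of_int (sign p) * (\<Prod>i\<in>UNIV. M x $ i $ p i))" for p
    by (intro multiform_mult multiform_const multiform_prod assms)
  then show ?thesis unfolding det_def by (intro multiform_sum) simp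
qed

lemma multiform_common_nonzero:
  assumes "multiform d F" "multiform e G" "F x \<noteq> 0" "G y \<noteq> 0"
  shows "\<exists>z. F z \<noteq> 0 \<and> G z \<noteq> 0"
  using assms poly_eval_common_nonzero unfolding multiform_def by blast

lemma multiform_prod_nonzero:
  assumes "finite A" "\<And>a. a \<in> A \<Longrightarrow> multiform (d a) (F a)" "\<And>a. a \<in> A \<Longrightarrow> \<exists>x. F a x \<noteq> 0"
  shows "\<exists>x. (\<Prod>a\<in>A. F a x) \<noteq> 0"
  using assms
proof (induction A rule: finite_induct)
  case (insert a A)
  obtain x where x: "(\<Prod>a\<in>A. F a x) \<noteq> 0" using insert.IH insert.prems by blast
  obtain y where y: "F a y \<noteq> 0" using insert.prems(2)[of a] by blast
  have "multiform (d a) (F a)" "multiform (\<lambda>j. \<Sum>a\<in>A. d a j) (\<lambda>x. \<Prod>a\<in>A. F a x)"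
    using insert.prems(1) by (simp_all add: multiform_prod)
  from multiform_common_nonzero[OF this y x] show ?case using insert.hyps by simp
qed simp

lemma multicoords_nonempty: "multicoords P \<noteq> {}"
proof -
  have "($) (rep_proj (P j)) \<in> coords (P j)" for j
    unfolding coords_def using point_rep_proj rep_proj_nonzero by blast
  then have "(\<lambda>(j, i). rep_proj (P j) $ i) \<in> multicoords P"
    by (simp add: multicoords_def)
  then show ?thesis by blast
qed

lemma topspace_multizariski: "topspace multizariski = UNIV"
proof -
  have "openin multizariski (UNIV :: ('r::finite \<Rightarrow> 'v::finite proj) set)"
    unfolding openin_multizariski
  proof (intro exI conjI ballI)
    show "UNIV = - zeros multicoords {1 :: ('r \<times> 'v) mpoly}"
      using multicoords_nonempty by (auto simp: zeros_def)
  qed (auto simp: multihomogeneous_def)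
  then show ?thesis using openin_subset by blast
qed

text \<open>A nonempty open set contains the nonvanishing locus of some polynomial \<open>g\<close> that is not
  identically zero. Then \<open>F\<close> and \<open>g\<close> have a common nonzero, and \<open>rows\<close> guarantees that this tuple
  of vectors represents a tuple of points.\<close>

lemma dense_nonvanishing_locus:
  fixes F :: "('r::finite \<times> 'v::finite \<Rightarrow> complex) \<Rightarrow> complex"
  assumes F: "multiform d F" and nz: "F x\<^sub>0 \<noteq> 0"
    and rows: "\<And>x j. F x \<noteq> 0 \<Longrightarrow> \<exists>i. x (j, i) \<noteq> 0"
  defines "U \<equiv> {P. \<exists>x\<in>multicoords P. F x \<noteq> 0}"
  shows "openin multizariski U" "multizariski closure_of U = UNIV"
proof -
  obtain f where f: "multihomogeneous d f" "F = poly_eval f"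
    using F unfolding multiform_def by blast
  have U: "U = - zeros multicoords {f}" unfolding U_def f(2) zeros_def by auto
  then show "openin multizariski U" unfolding openin_multizariski using f(1) by blast
  have "\<exists>R. R \<in> U \<and> R \<in> W" if QW: "Q \<in> W" and W: "openin multizariski W" for Q W
  proof -
    obtain G where G: "\<forall>g\<in>G. \<exists>d. multihomogeneous d g" "W = - zeros multicoords G"
      using W unfolding openin_multizariski by blast
    obtain g y where g: "g \<in> G" "poly_eval g y \<noteq> 0"
      using QW unfolding G(2) zeros_def by auto
    obtain z where z: "poly_eval f z \<noteq> 0" "poly_eval g z \<noteq> 0"
      using poly_eval_common_nonzero nz g(2) unfolding f(2) by blast
    let ?R = "\<lambda>j. point (\<chi> i. z (j, i))"
    have "(\<chi> i. z (j, i)) \<noteq> 0" for j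
      using rows[of z j] z(1) f(2) by (auto simp: vec_eq_iff)
    then have "(\<lambda>i. z (j, i)) \<in> coords (?R j)" for j
      unfolding coords_def by (auto intro!: exI[of _ "\<chi> i. z (j, i)"])
    then have "z \<in> multicoords ?R" by (simp add: multicoords_def)
    then have "?R \<in> U \<and> ?R \<in> W" unfolding U G(2) zeros_def using z g(1) by auto
    then show ?thesis by blast
  qed
  then show "multizariski closure_of U = UNIV"
    unfolding closure_of_def topspace_multizariski by auto
qed

section \<open>The generic determinants\<close>

text \<open>Up to the common factor \<open>\<Prod>l. x (j, l)\<close> these are the inverses of the coordinates of the
  \<open>j\<close>-th point, in a form that is polynomial and makes sense also when coordinates vanish.\<close>

definition cremona :: "('r \<times> 'v::finite \<Rightarrow> complex) \<Rightarrow> 'r \<Rightarrow> 'v \<Rightarrow> complex" where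
  "cremona x j k = (\<Prod>l\<in>UNIV - {k}. x (j, l))"

text \<open>The partial map \<open>\<sigma>\<close> says which of the \<open>r\<close> rows is placed at which position of a square matrix;
  free positions receive unit vectors. This makes one square determinant out of any choice of at
  most \<open>CARD('v)\<close> rows, whether or not \<open>r\<close> is smaller than \<open>CARD('v)\<close>.\<close>

definition padded_minor :: "('v \<rightharpoonup> 'r) \<Rightarrow> ('r \<times> 'v::finite \<Rightarrow> complex) \<Rightarrow> complex ^ 'v ^ 'v" where
  "padded_minor \<sigma> x =
    (\<chi> i k. case \<sigma> i of None \<Rightarrow> of_bool (i = k) | Some j \<Rightarrow> cremona x j k)"

lemma cremona_eq_divide:
  assumes "x (j, k) \<noteq> 0"
  shows "cremona x j k = (\<Prod>l\<in>UNIV. x (j, l)) / x (j, k)"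
  using assms prod.remove[of UNIV k "\<lambda>l. x (j, l)"] by (simp add: cremona_def)

lemma multiform_cremona:
  "multiform (\<lambda>j'. of_bool (j' = j) * (CARD('v) - 1))
    (\<lambda>x :: 'r::finite \<times> 'v::finite \<Rightarrow> complex. cremona x j k)"
proof -
  have "multiform (\<lambda>j'. \<Sum>l\<in>UNIV - {k}. of_bool (j' = j)) (\<lambda>x. cremona x j k)"
    unfolding cremona_def by (intro multiform_prod multiform_coordinate)
  then show ?thesis by (simp add: mult.commute)
qed

lemma multiform_det_padded_minor: "\<exists>d. multiform d (\<lambda>x. det (padded_minor \<sigma> x))"
proof -
  let ?d = "\<lambda>i j'. case \<sigma> i of None \<Rightarrow> 0 | Some j \<Rightarrow> of_bool (j' = j) * (CARD('b) - 1)"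
  have "multiform (?d i) (\<lambda>x. padded_minor \<sigma> x $ i $ k)" for i k
    by (cases "\<sigma> i") (simp_all add: padded_minor_def multiform_const multiform_cremona[simplified])
  from multiform_det[of ?d "padded_minor \<sigma>", OF this] show ?thesis by blast
qed

lemma det_padded_minor_nonzero:
  fixes \<sigma> :: "'v::finite \<rightharpoonup> 'r"
  assumes "inj_on \<sigma> (dom \<sigma>)"
  shows "\<exists>x. det (padded_minor \<sigma> x) \<noteq> 0"
proof -
  \<comment> \<open>Row \<open>j\<close> of this tuple is zero exactly at the position to which \<open>\<sigma>\<close> assigns \<open>j\<close>, so the product of
    the other coordinates is nonzero at that position only.\<close>
  let ?x = "\<lambda>(j, l). if \<sigma> l = Some j then 0 else 1 :: complex"
  have "cremona ?x j k = of_bool (i = k)" if i: "\<sigma> i = Some j" for i j k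
  proof -
    have iff: "\<sigma> l = Some j \<longleftrightarrow> l = i" for l
      using assms i by (metis domI inj_onD)
    show ?thesis by (auto simp: cremona_def iff prod_zero_iff intro!: prod.neutral)
  qed
  then have "padded_minor \<sigma> ?x = mat 1"
    by (auto simp: padded_minor_def mat_def vec_eq_iff split: option.split)
  then have "det (padded_minor \<sigma> ?x) \<noteq> 0" by simp
  then show ?thesis by blast
qed

section \<open>Linear forms and Hadamard transformations\<close>

definition linear_form :: "('v \<Rightarrow> complex) \<Rightarrow> 'v::finite mpoly" where
  "linear_form a = (\<Sum>i\<in>UNIV. Poly_Mapping.single (Poly_Mapping.single i 1) (a i))"

lemma poly_eval_linear_form: "poly_eval (linear_form a) x = (\<Sum>i\<in>UNIV. a i * x i)"
proof -
  have single: "(\<Prod>k\<in>UNIV. x k ^ Poly_Mapping.lookup (Poly_Mapping.single i 1) k) = x i" for i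
  proof -
    have "(\<Prod>k\<in>UNIV. x k ^ Poly_Mapping.lookup (Poly_Mapping.single i 1) k) =
        (\<Prod>k\<in>UNIV. if k = i then x k else 1)"
      by (rule prod.cong) (auto simp: lookup_single when_def)
    then show ?thesis by simp
  qed
  have "poly_eval (\<Sum>i\<in>A. Poly_Mapping.single (Poly_Mapping.single i 1) (a i)) x =
      (\<Sum>i\<in>A. a i * x i)" for A
    by (induction A rule: infinite_finite_induct)
      (simp_all add: poly_eval_add poly_eval_single single[simplified])
  then show ?thesis by (simp add: linear_form_def)
qed

lemma linear_form_in_linear_forms: "linear_form a \<in> linear_forms"
proof -
  have "Poly_Mapping.keys (linear_form a) \<subseteq>
      (\<Union>i\<in>UNIV. Poly_Mapping.keys (Poly_Mapping.single (Poly_Mapping.single i 1) (a i)))"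
    unfolding linear_form_def by (rule keys_sum)
  moreover have "(\<Sum>k\<in>UNIV. Poly_Mapping.lookup (Poly_Mapping.single i (1::nat)) k) = 1" for i :: 'a
    by (simp add: lookup_single when_def)
  ultimately show ?thesis unfolding linear_forms_def homogeneous_def
    by (fastforce split: if_splits)
qed

lemma poly_eval_in_linear_forms:
  assumes "L \<in> linear_forms"
  obtains a where "\<And>x. poly_eval L x = (\<Sum>i\<in>UNIV. a i * x i)"
proof -
  have keys: "Poly_Mapping.keys L \<subseteq> range (\<lambda>i. Poly_Mapping.single i (1::nat))"
  proof
    fix m assume "m \<in> Poly_Mapping.keys L"
    then have "(\<Sum>i\<in>UNIV. Poly_Mapping.lookup m i) = 1"
      using assms by (simp add: linear_forms_def homogeneous_def)
    then obtain i where "Poly_Mapping.lookup m i = 1" "\<And>k. k \<noteq> i \<Longrightarrow> Poly_Mapping.lookup m k = 0"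
      using sum_eq_1_iff[of UNIV "Poly_Mapping.lookup m"] by auto
    then have "m = Poly_Mapping.single i 1"
      by (intro poly_mapping_eqI) (auto simp: lookup_single when_def)
    then show "m \<in> range (\<lambda>i. Poly_Mapping.single i 1)" by blast
  qed
  let ?s = "\<lambda>i. Poly_Mapping.single i (1::nat)"
  have "L = linear_form (\<lambda>i. Poly_Mapping.lookup L (?s i))"
  proof (rule poly_mapping_eqI)
    fix m
    have inj: "?s i = ?s k \<longleftrightarrow> i = k" for i k
      by (metis lookup_single_eq lookup_single_not_eq zero_neq_one)
    show "Poly_Mapping.lookup L m = Poly_Mapping.lookup (linear_form (\<lambda>i. Poly_Mapping.lookup L (?s i))) m"
    proof (cases "m \<in> range ?s")
      case True
      then obtain i where "m = ?s i" by blast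
      then show ?thesis by (simp add: linear_form_def lookup_sum lookup_single when_def inj[simplified] cong: if_cong)
    next
      case False
      then have "Poly_Mapping.lookup L m = 0" using keys by (meson in_keys_iff subsetD)
      moreover have "?s i \<noteq> m" for i using False by blast
      ultimately show ?thesis by (simp add: linear_form_def lookup_sum lookup_single when_def)
    qed
  qed
  then show thesis using that poly_eval_linear_form by metis
qed

lemma point_in_zero_locus:
  assumes "b \<noteq> 0" and "\<And>f. f \<in> F \<Longrightarrow> f \<in> linear_forms"
  shows "point b \<in> V F \<longleftrightarrow> (\<forall>f\<in>F. poly_eval f (($) b) = 0)"
proof
  have "($) b \<in> coords (point b)" using assms(1) by (auto simp: coords_def)
  then show "\<forall>f\<in>F. poly_eval f (($) b) = 0" if "point b \<in> V F"
    using that by (auto simp: zeros_def)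
  show "point b \<in> V F" if 0: "\<forall>f\<in>F. poly_eval f (($) b) = 0"
    unfolding zeros_def
  proof (intro CollectI ballI)
    fix f y assume "f \<in> F" "y \<in> coords (point b)"
    then obtain k where "y = (\<lambda>i. k * b $ i)"
      using coords_scale \<open>($) b \<in> coords (point b)\<close> by blast
    moreover have "homogeneous 1 f" using assms(2) \<open>f \<in> F\<close> by (auto simp: linear_forms_def)
    ultimately show "poly_eval f y = 0"
      using 0 \<open>f \<in> F\<close> by (simp add: poly_eval_homogeneous)
  qed
qed

lemma point_in_hyperplane:
  assumes "b \<noteq> 0" "L \<in> linear_forms"
  shows "point b \<in> V {L} \<longleftrightarrow> poly_eval L (($) b) = 0"
  using point_in_zero_locus[of b "{L}"] assms by simp

lemma closedin_zariski_zero_locus: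
  assumes "homogeneous d f"
  shows "closedin zariski (V {f})"
proof -
  have "openin zariski (UNIV :: 'a proj set)"
    unfolding openin_zariski
  proof (intro exI conjI ballI)
    show "UNIV = - V {1 :: 'a mpoly}" using coords_nonempty by (auto simp: zeros_def)
  qed (auto simp: homogeneous_def)
  then have "topspace (zariski :: 'a proj topology) = UNIV" using openin_subset by blast
  moreover have "openin zariski (- V {f})"
    unfolding openin_zariski
    using assms by (intro exI[of _ "{f}"]) auto
  ultimately show ?thesis by (simp add: closedin_def Compl_eq_Diff_UNIV)
qed

text \<open>When no coordinate of \<open>p\<close> vanishes, multiplication by \<open>p\<close> is an everywhere defined bijection
  with coordinatewise division as its inverse. Hence the set of products is already a hyperplane,
  and taking the closure adds nothing.\<close>

lemma hadamard_variety_hyperplane: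
  fixes p :: "complex ^ 'v::finite"
  assumes p: "\<And>i. p $ i \<noteq> 0"
    and M: "M \<in> linear_forms" "\<And>x. poly_eval M x = (\<Sum>i\<in>UNIV. a i * x i)"
  shows "point p \<star> V {M} = V {linear_form (\<lambda>i. a i / p $ i)}" (is "_ = V {?L}")
proof -
  have p0: "p \<noteq> 0" using p by auto
  have had: "hadamard (point p) (point b) = Some (point (\<chi> i. p $ i * b $ i))" if "b \<noteq> 0" for b
    using that p p0 by (auto simp: hadamard_point vec_eq_iff)
  have L: "?L \<in> linear_forms" by (rule linear_form_in_linear_forms)
  have "{R. \<exists>Q\<in>V {M}. hadamard (point p) Q = Some R} = V {?L}"
  proof (intro equalityI subsetI)
    fix R assume "R \<in> {R. \<exists>Q\<in>V {M}. hadamard (point p) Q = Some R}"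
    then obtain Q where Q: "Q \<in> V {M}" "hadamard (point p) Q = Some R" by blast
    define b where "b = rep_proj Q"
    have b: "b \<noteq> 0" "Q = point b" by (simp_all add: b_def rep_proj_nonzero point_rep_proj)
    let ?c = "\<chi> i. p $ i * b $ i"
    have "?c \<noteq> 0" using b(1) p by (auto simp: vec_eq_iff)
    then have "point ?c \<in> V {?L} \<longleftrightarrow> (\<Sum>i\<in>UNIV. a i * b $ i) = 0"
      using p L by (simp add: point_in_hyperplane poly_eval_linear_form)
    moreover have "(\<Sum>i\<in>UNIV. a i * b $ i) = 0"
      using Q(1) M b by (simp add: point_in_hyperplane)
    ultimately show "R \<in> V {?L}" using Q(2) b had by simp
  next
    fix R assume R: "R \<in> V {?L}"
    define c where "c = rep_proj R"
    have c: "c \<noteq> 0" "R = point c" by (simp_all add: c_def rep_proj_nonzero point_rep_proj)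
    let ?b = "\<chi> i. c $ i / p $ i"
    have b0: "?b \<noteq> 0" using c(1) p by (auto simp: vec_eq_iff)
    have "poly_eval ?L (($) c) = 0" using R L c by (simp add: point_in_hyperplane)
    then have "point ?b \<in> V {M}"
      using M b0 by (simp add: point_in_hyperplane poly_eval_linear_form)
    moreover have "hadamard (point p) (point ?b) = Some R"
      using had[OF b0] p c by simp
    ultimately show "R \<in> {R. \<exists>Q\<in>V {M}. hadamard (point p) Q = Some R}" by blast
  qed
  moreover have "closedin zariski (V {?L})"
    using L closedin_zariski_zero_locus unfolding linear_forms_def by blast
  ultimately show ?thesis by (simp only: hadamard_variety_def closure_of_closedin)
qed

section \<open>General linearity\<close>

text \<open>The map \<open>T\<close> below first scales the coordinates by \<open>a\<close> and then applies a padded minor whose rows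
  include those with index in \<open>J\<close>. It is bijective, and at the positions of these rows its values are
  nonzero multiples of the given linear forms. So it carries their common kernel onto a coordinate
  subspace of codimension \<open>card J\<close>.\<close>

lemma dim_common_kernel:
  fixes a :: "'v::finite \<Rightarrow> complex" and x :: "'r::finite \<times> 'v \<Rightarrow> complex"
  assumes a: "\<And>i. a i \<noteq> 0" and x: "\<And>q. x q \<noteq> 0"
    and det: "\<And>\<sigma>. inj_on \<sigma> (dom \<sigma>) \<Longrightarrow> det (padded_minor \<sigma> x) \<noteq> 0"
    and J: "card J \<le> CARD('v)"
  shows "vec.dim {b :: complex ^ 'v. \<forall>j\<in>J. (\<Sum>k\<in>UNIV. a k / x (j, k) * b $ k) = 0} + card J = CARD('v)"
proof -
  obtain \<phi> :: "'r \<Rightarrow> 'v" where \<phi>: "inj_on \<phi> J"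
    using card_le_inj[of J "UNIV :: 'v set"] J by auto
  define \<sigma> where "\<sigma> i = (if i \<in> \<phi> ` J then Some (inv_into J \<phi> i) else None)" for i
  have \<sigma>: "\<sigma> (\<phi> j) = Some j" if "j \<in> J" for j
    using that \<phi> by (simp add: \<sigma>_def)
  have dom: "dom \<sigma> = \<phi> ` J" by (auto simp: \<sigma>_def dom_def)
  have "inj_on \<sigma> (dom \<sigma>)" unfolding dom by (auto simp: inj_on_def \<sigma>)
  then have "invertible (padded_minor \<sigma> x)" using det by (simp add: invertible_det_nz)
  define T where "T b = padded_minor \<sigma> x *v (\<chi> k. a k * b $ k)" for b :: "complex ^ 'v"
  have lin: "Vector_Spaces.linear (*s) (*s) T"
  proof -
    have "T = (*v) (\<chi> i k. padded_minor \<sigma> x $ i $ k * a k)"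
      by (auto simp: T_def fun_eq_iff vec_eq_iff matrix_vector_mult_def mult.assoc)
    then show ?thesis by simp
  qed
  have inj: "inj T"
  proof (rule injI)
    fix b c assume "T b = T c"
    then have "(\<chi> k. a k * b $ k) = (\<chi> k. a k * c $ k)"
      unfolding T_def using inj_matrix_vector_mult[OF \<open>invertible _\<close>] by (simp add: inj_eq)
    then show "b = c" using a by (simp add: vec_eq_iff)
  qed
  have surj: "surj T" using vec.linear_inj_imp_surj[OF lin inj] .
  have T: "T b $ \<phi> j = (\<Prod>l\<in>UNIV. x (j, l)) * (\<Sum>k\<in>UNIV. a k / x (j, k) * b $ k)"
    if "j \<in> J" for b j
    using x by (simp add: T_def matrix_vector_mult_def padded_minor_def \<sigma>[OF that]
        cremona_eq_divide sum_distrib_left mult.assoc)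
  let ?K = "{b :: complex ^ 'v. \<forall>j\<in>J. (\<Sum>k\<in>UNIV. a k / x (j, k) * b $ k) = 0}"
  have K: "?K = {b. \<forall>i. i \<notin> - \<phi> ` J \<longrightarrow> T b $ i = 0}"
    using x by (auto simp: T)
  have "T ` ?K = {c. \<forall>i. i \<notin> - \<phi> ` J \<longrightarrow> c $ i = 0}"
    unfolding K using surj by (auto simp: image_iff)
  then have "vec.dim (T ` ?K) = card (- \<phi> ` J)"
    by (simp only: dim_substandard_cart)
  then have "vec.dim ?K = card (- \<phi> ` J)"
    using vec.dim_image_eq[OF lin inj_on_subset[OF inj subset_UNIV], of ?K] by simp
  also have "\<dots> + card J = CARD('v)"
    using card_image[OF \<phi>] J by (simp add: Compl_eq_Diff_UNIV card_Diff_subset)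
  finally show ?thesis .
qed

text \<open>For at most \<open>n\<close> forms the cone over the common zero locus is the kernel just computed. For
  more than \<open>n\<close> forms, \<open>n + 1 = CARD('v)\<close> of them have only the trivial common zero already.\<close>

lemma generally_linear_of_minors:
  fixes a :: "'v::finite \<Rightarrow> complex" and x :: "'r::finite \<times> 'v \<Rightarrow> complex"
  assumes a: "\<And>i. a i \<noteq> 0" and x: "\<And>q. x q \<noteq> 0"
    and det: "\<And>\<sigma>. inj_on \<sigma> (dom \<sigma>) \<Longrightarrow> det (padded_minor \<sigma> x) \<noteq> 0"
  shows "generally_linear (\<lambda>j. linear_form (\<lambda>i. a i / x (j, i)))" (is "generally_linear ?L")
proof -
  let ?K = "\<lambda>J. {b :: complex ^ 'v. \<forall>j\<in>J. (\<Sum>k\<in>UNIV. a k / x (j, k) * b $ k) = 0}"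
  have mem: "point b \<in> V (?L ` J) \<longleftrightarrow> b \<in> ?K J" if "b \<noteq> 0" for b J
    using that by (subst point_in_zero_locus) (auto simp: linear_form_in_linear_forms poly_eval_linear_form)
  have cone: "{b. b = 0 \<or> point b \<in> V (?L ` J)} = ?K J" for J
  proof (rule set_eqI)
    show "b \<in> {b. b = 0 \<or> point b \<in> V (?L ` J)} \<longleftrightarrow> b \<in> ?K J" for b
      using mem[of b J] by (cases "b = 0") simp_all
  qed
  have pos: "CARD('v) > 0" by simp
  show ?thesis
    unfolding generally_linear_def Let_def
  proof (intro conjI allI impI)
    fix J :: "'r set"
    show "linear_dim (V (?L ` J)) = int (CARD('v) - 1) - int (card J)" if "card J \<le> CARD('v) - 1"
      using dim_common_kernel[of a x J, OF a x det] that pos unfolding linear_dim_def cone by linarith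
    show "V (?L ` J) = {}" if "card J > CARD('v) - 1"
    proof -
      have "CARD('v) \<le> card J" using that by linarith
      then obtain I where I: "I \<subseteq> J" "card I = CARD('v)"
        by (rule obtain_subset_with_card_n)
      then have "vec.dim (?K I) = 0" using dim_common_kernel[of a x I, OF a x det] by simp
      then have "?K I \<subseteq> {0}" by (simp only: vec.dim_eq_0)
      then have "?K J \<subseteq> {0}" using I(1) by blast
      moreover have "rep_proj Q \<in> ?K J" if "Q \<in> V (?L ` J)" for Q
        using that mem[OF rep_proj_nonzero, of Q J] by (simp only: point_rep_proj)
      ultimately show ?thesis using rep_proj_nonzero by blast
    qed
  qed (rule linear_form_in_linear_forms)
qed

text \<open>The value of the form \<open>M\<close> at the \<open>k\<close>-th unit vector is \<open>a k\<close>.\<close>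

lemma coefficients_nonzero:
  assumes M: "M \<in> linear_forms" "\<And>x. poly_eval M x = (\<Sum>i\<in>UNIV. a i * x i)"
    and "V {M} \<inter> coordinate_points = {}"
  shows "a k \<noteq> 0"
proof
  assume "a k = 0"
  have "axis k (1::complex) \<noteq> 0" by (simp add: axis_eq_0_iff)
  moreover have "(\<Sum>i\<in>UNIV. a i * axis k 1 $ i) = 0"
    using \<open>a k = 0\<close> by (intro sum.neutral) (auto simp: axis_def)
  ultimately have "point (axis k 1) \<in> V {M}"
    using M by (simp add: point_in_hyperplane)
  then show False using assms(3) by (auto simp: coordinate_points_def)
qed

text \<open>All genericity conditions are multiplied into a single polynomial \<open>F\<close>.\<close>

lemma generic_multiform:
  obtains d and F :: "('r::finite \<times> 'v::finite \<Rightarrow> complex) \<Rightarrow> complex" and x\<^sub>0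
  where "multiform d F" "F x\<^sub>0 \<noteq> 0"
    "\<And>x q. F x \<noteq> 0 \<Longrightarrow> x q \<noteq> 0"
    "\<And>x \<sigma>. F x \<noteq> 0 \<Longrightarrow> inj_on \<sigma> (dom \<sigma>) \<Longrightarrow> det (padded_minor \<sigma> x) \<noteq> 0"
proof -
  let ?S = "{\<sigma> :: 'v \<rightharpoonup> 'r. inj_on \<sigma> (dom \<sigma>)}"
  let ?C = "\<lambda>x :: 'r \<times> 'v \<Rightarrow> complex. \<Prod>q\<in>UNIV. x q"
  let ?D = "\<lambda>x. \<Prod>\<sigma>\<in>?S. det (padded_minor \<sigma> x)"
  obtain e where e: "\<And>\<sigma> :: 'v \<rightharpoonup> 'r. multiform (e \<sigma>) (\<lambda>x. det (padded_minor \<sigma> x))"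
    using multiform_det_padded_minor by metis
  have fin: "finite ?S" by simp
  have D: "multiform (\<lambda>j. \<Sum>\<sigma>\<in>?S. e \<sigma> j) ?D" by (intro multiform_prod e)
  obtain y where y: "?D y \<noteq> 0"
    using multiform_prod_nonzero[OF fin, of e "\<lambda>\<sigma> x. det (padded_minor \<sigma> x)"] e
      det_padded_minor_nonzero by blast
  have C: "multiform (\<lambda>j. \<Sum>q\<in>(UNIV :: ('r \<times> 'v) set). of_bool (j = fst q)) ?C"
  proof -
    have coordinate: "multiform (\<lambda>j. of_bool (j = fst q)) (\<lambda>x. x q)" for q :: "'r \<times> 'v"
      using multiform_coordinate[of "fst q" "snd q"] by simp
    show ?thesis
      by (rule multiform_prod[where d = "\<lambda>q j. of_bool (j = fst q)" and F = "\<lambda>q x. x q"])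
        (rule coordinate)
  qed
  have C1: "?C (\<lambda>_. 1) \<noteq> 0" by simp
  obtain z where z: "?C z \<noteq> 0" "?D z \<noteq> 0"
    using multiform_common_nonzero[of _ ?C _ ?D, OF C D C1 y] by blast
  show thesis
  proof (rule that)
    show "multiform (\<lambda>j. (\<Sum>q\<in>(UNIV :: ('r \<times> 'v) set). of_bool (j = fst q)) + (\<Sum>\<sigma>\<in>?S. e \<sigma> j)) (\<lambda>x. ?C x * ?D x)"
      by (rule multiform_mult[OF C D])
    show "?C z * ?D z \<noteq> 0" using z by simp
  next
    fix x q assume "?C x * ?D x \<noteq> 0"
    then show "x q \<noteq> 0" by (cases q) (simp add: prod_zero_iff)
  next
    fix x and \<sigma> :: "'v \<rightharpoonup> 'r" assume "?C x * ?D x \<noteq> 0" "inj_on \<sigma> (dom \<sigma>)"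
    then show "det (padded_minor \<sigma> x) \<noteq> 0" by (simp add: prod_zero_iff)
  qed
qed

section \<open>Generic weak Hadamard star configurations\<close>

theorem corollary4p5:
  fixes n r c :: nat
  assumes "CARD('v::finite) = n + 1" and "CARD('r::finite) = r"
    and "n \<ge> 1" and "r \<ge> 1" and "c \<in> {1..n}"
  shows "\<exists>U :: ('r \<Rightarrow> 'v proj) set.
    openin multizariski U \<and> multizariski closure_of U = UNIV \<and>
    (\<forall>P\<in>U. \<forall>H. hyperplane H \<and> H \<inter> coordinate_points = {} \<longrightarrow>
      (\<exists>L. (\<forall>j. P j \<star> H = V {L j}) \<and>
        weak_hadamard_star_configuration c L (star_configuration c (\<lambda>j. P j \<star> H))))"
proof -
  obtain d and F :: "('r \<times> 'v \<Rightarrow> complex) \<Rightarrow> complex" and x\<^sub>0 where F: "multiform d F" "F x\<^sub>0 \<noteq> 0"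
    and coord: "\<And>x q. F x \<noteq> 0 \<Longrightarrow> x q \<noteq> 0"
    and det: "\<And>x \<sigma>. F x \<noteq> 0 \<Longrightarrow> inj_on \<sigma> (dom \<sigma>) \<Longrightarrow> det (padded_minor \<sigma> x) \<noteq> 0"
    by (rule generic_multiform) blast
  let ?U = "{P. \<exists>x\<in>multicoords P. F x \<noteq> 0}"
  have U: "openin multizariski ?U" "multizariski closure_of ?U = UNIV"
    using dense_nonvanishing_locus[OF F] coord by blast+
  have "\<exists>L. (\<forall>j. P j \<star> H = V {L j}) \<and>
        weak_hadamard_star_configuration c L (star_configuration c (\<lambda>j. P j \<star> H))"
    if P: "P \<in> ?U" and H: "hyperplane H" "H \<inter> coordinate_points = {}" for P H
  proof -
    obtain x where x: "x \<in> multicoords P" "F x \<noteq> 0" using P by blast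
    obtain M where M: "M \<in> linear_forms" "H = V {M}" using H(1) unfolding hyperplane_def by blast
    obtain a where a: "\<And>x. poly_eval M x = (\<Sum>i\<in>UNIV. a i * x i)"
      using poly_eval_in_linear_forms[OF M(1)] by blast
    have a0: "a i \<noteq> 0" for i using coefficients_nonzero[OF M(1) a] H(2) M(2) by blast
    let ?L = "\<lambda>j. linear_form (\<lambda>i. a i / x (j, i))"
    have PH: "P j \<star> H = V {?L j}" for j
    proof -
      obtain p where p: "(\<lambda>i. x (j, i)) = ($) p" "point p = P j"
        using x(1) unfolding multicoords_def coords_def by blast
      have px: "x (j, i) = p $ i" for i using p(1) by metis
      have "p $ i \<noteq> 0" for i
        using coord[OF x(2), of "(j, i)"] by (simp add: px)
      then have "point p \<star> V {M} = V {linear_form (\<lambda>i. a i / p $ i)}"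
        by (rule hadamard_variety_hyperplane[OF _ M(1) a])
      then show ?thesis by (simp add: p(2) M(2) px)
    qed
    have "generally_linear ?L"
      using generally_linear_of_minors[OF a0 coord[OF x(2)] det[OF x(2)]] .
    moreover have "hadamard_set ?L"
      unfolding hadamard_set_def using PH M by metis
    ultimately have "weak_hadamard_star_configuration c ?L (star_configuration c (\<lambda>j. P j \<star> H))"
      unfolding weak_hadamard_star_configuration_def using PH assms by simp
    then show ?thesis using PH by (intro exI[of _ ?L]) simp
  qed
  then show ?thesis using U by blast
qed

end
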